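(* Let $(X,d_X)$ be a compact metric space, $\mathbb{F}$ a field and $k$ a nonnegative integer. Then any $I\in\mathrm{barc}_k^{\mathrm{VR}}(X;\mathbb{F})$ must be either of the form $(u,v]$ or of the form $(u,\infty)$ for some $0\le u<v<\infty$.
   Context: For $r>0$, $\mathrm{VR}_r(X)$ is the simplicial complex whose vertices are the points of $X$ and whose simplices are the nonempty finite subsets of $X$ of diameter strictly less than $r$. $\mathrm{PH}_k(\mathrm{VR}_*(X);\mathbb{F})$ is the persistence module over $(0,\infty)$ given by $\mathrm{H}_k(\mathrm{VR}_r(X);\mathbb{F})$, $r>0$, with maps induced by inclusions. For compact $X$ it is isomorphic to a direct sum $\bigoplus_\lambda\mathbb{F}_*[I_\lambda]$ of interval modules ($\mathbb{F}_*[I]$ is $\mathbb{F}$ at indices in $I$, $0$ elsewhere, with identity maps inside $I$), and $\mathrm{barc}_k^{\mathrm{VR}}(X;\mathbb{F})$ denotes the (unique) multiset $(I_\lambda)$ of nonempty intervals. *)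

theory Defs
  imports "HOL-Analysis.Analysis" "HOL-Library.Poly_Mapping" "HOL-Algebra.Module"
    "HOL-Algebra.AbelCoset"
begin

text \<open>
  Vector spaces over a field \<open>'f\<close> (a type of class \<^class>\<open>field\<close>) are represented by the
  records of HOL-Algebra's modules, with scalars ranging over the whole type.  The ring
  multiplication and its unit, which these records inherit, are meaningless here.
\<close>

definition vec_space ::
  "'v set \<Rightarrow> 'v \<Rightarrow> ('v \<Rightarrow> 'v \<Rightarrow> 'v) \<Rightarrow> ('f \<Rightarrow> 'v \<Rightarrow> 'v) \<Rightarrow> ('f, 'v) module" where
  "vec_space V z p m =
    \<lparr>carrier = V, mult = undefined, one = undefined, zero = z, add = p, smult = m\<rparr>"

definition linear_iso ::
  "('f::field, 'v) module \<Rightarrow> ('f, 'w) module \<Rightarrow> ('v \<Rightarrow> 'w) \<Rightarrow> bool" where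
  "linear_iso V W f \<longleftrightarrow>
    bij_betw f (carrier V) (carrier W) \<and>
    (\<forall>x\<in>carrier V. \<forall>y\<in>carrier V. f (x \<oplus>\<^bsub>V\<^esub> y) = f x \<oplus>\<^bsub>W\<^esub> f y) \<and>
    (\<forall>a. \<forall>x\<in>carrier V. f (a \<odot>\<^bsub>V\<^esub> x) = a \<odot>\<^bsub>W\<^esub> f x)"

text \<open>The union below is over equal cosets, since \<open>N\<close> is a subspace of \<open>V\<close>.\<close>

definition quotient_space :: "('f::field, 'v) module \<Rightarrow> 'v set \<Rightarrow> ('f, 'v set) module" where
  "quotient_space V N =
    vec_space (a_rcosets\<^bsub>V\<^esub> N) N (set_add V) (\<lambda>a A. \<Union>x\<in>A. N +>\<^bsub>V\<^esub> (a \<odot>\<^bsub>V\<^esub> x))"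

definition direct_sum_space ::
  "'l set \<Rightarrow> ('l \<Rightarrow> ('f::field, 'v) module) \<Rightarrow> ('f, 'l \<Rightarrow> 'v) module" where
  "direct_sum_space L V =
    vec_space {x \<in> (\<Pi>\<^sub>E l\<in>L. carrier (V l)). finite {l\<in>L. x l \<noteq> \<zero>\<^bsub>V l\<^esub>}}
      (\<lambda>l\<in>L. \<zero>\<^bsub>V l\<^esub>)
      (\<lambda>x y. \<lambda>l\<in>L. x l \<oplus>\<^bsub>V l\<^esub> y l)
      (\<lambda>a x. \<lambda>l\<in>L. a \<odot>\<^bsub>V l\<^esub> x l)"


section \<open>Simplicial homology with field coefficients\<close>

text \<open>
  A simplicial complex is given by the set of its simplices, which are nonempty finite sets of
  vertices.  Simplices are oriented by means of one fixed total order on the type of vertices;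
  the choice affects homology, and the maps induced by inclusions, only up to natural
  isomorphism.
\<close>

definition vertex_order :: "'a rel" where
  "vertex_order = (SOME r. linear_order r)"

definition simplices :: "nat \<Rightarrow> 'a set set \<Rightarrow> 'a set set" where
  "simplices k K = {\<sigma>\<in>K. card \<sigma> = Suc k}"

definition chain_scale :: "'f::field \<Rightarrow> ('a set \<Rightarrow>\<^sub>0 'f) \<Rightarrow> ('a set \<Rightarrow>\<^sub>0 'f)" where
  "chain_scale a = Poly_Mapping.map ((*) a)"

definition chains :: "nat \<Rightarrow> 'a set set \<Rightarrow> ('a set \<Rightarrow>\<^sub>0 'f::field) set" where
  "chains k K = {c. Poly_Mapping.keys c \<subseteq> simplices k K}"

definition incidence_sign :: "'a set \<Rightarrow> 'a \<Rightarrow> 'f::field" where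
  "incidence_sign \<sigma> v = (- 1) ^ card {w\<in>\<sigma>. w \<noteq> v \<and> (w, v) \<in> vertex_order}"

text \<open>
  For \<open>\<sigma> = {v\<^sub>0 < \<dots> < v\<^sub>k}\<close> this is the sum of \<open>(-1)\<^sup>i (\<sigma> - {v\<^sub>i})\<close> over \<open>i \<le> k\<close>.  The empty set is
  not a simplex (the homology is unreduced), so that the boundary of a vertex is zero.
\<close>

definition simplex_boundary :: "'a set \<Rightarrow> ('a set \<Rightarrow>\<^sub>0 'f::field)" where
  "simplex_boundary \<sigma> =
    (\<Sum>v | v \<in> \<sigma> \<and> \<sigma> - {v} \<noteq> {}. Poly_Mapping.single (\<sigma> - {v}) (incidence_sign \<sigma> v))"

definition boundary :: "('a set \<Rightarrow>\<^sub>0 'f::field) \<Rightarrow> ('a set \<Rightarrow>\<^sub>0 'f)" where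
  "boundary c =
    (\<Sum>\<sigma>\<in>Poly_Mapping.keys c. chain_scale (Poly_Mapping.lookup c \<sigma>) (simplex_boundary \<sigma>))"

definition cycles :: "nat \<Rightarrow> 'a set set \<Rightarrow> ('a set \<Rightarrow>\<^sub>0 'f::field) set" where
  "cycles k K = {c \<in> chains k K. boundary c = 0}"

definition boundaries :: "nat \<Rightarrow> 'a set set \<Rightarrow> ('a set \<Rightarrow>\<^sub>0 'f::field) set" where
  "boundaries k K = boundary ` chains (Suc k) K"

definition cycle_space :: "nat \<Rightarrow> 'a set set \<Rightarrow> ('f::field, 'a set \<Rightarrow>\<^sub>0 'f) module" where
  "cycle_space k K = vec_space (cycles k K) 0 (+) chain_scale"

definition homology :: "nat \<Rightarrow> 'a set set \<Rightarrow> ('f::field, ('a set \<Rightarrow>\<^sub>0 'f) set) module" where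
  "homology k K = quotient_space (cycle_space k K) (boundaries k K)"

text \<open>
  For a subcomplex \<open>K\<close> of \<open>K'\<close>, the map induced by the inclusion sends the class of a cycle \<open>z\<close>
  of \<open>K\<close> to its class in \<open>K'\<close>; again the union is over equal cosets.
\<close>

definition homology_incl ::
  "nat \<Rightarrow> 'a set set \<Rightarrow> ('a set \<Rightarrow>\<^sub>0 'f::field) set \<Rightarrow> ('a set \<Rightarrow>\<^sub>0 'f) set" where
  "homology_incl k K' A = (\<Union>z\<in>A. boundaries k K' +>\<^bsub>cycle_space k K'\<^esub> z)"


section \<open>Persistence modules over the positive reals\<close>

text \<open>Only the spaces at \<open>t > 0\<close> and the maps for \<open>0 < s \<le> t\<close> are relevant.\<close>

record ('f, 'v) pers_module =
  pm_space :: "real \<Rightarrow> ('f, 'v) module"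
  pm_map :: "real \<Rightarrow> real \<Rightarrow> 'v \<Rightarrow> 'v"

definition pm_isomorphic ::
  "('f::field, 'v) pers_module \<Rightarrow> ('f, 'w) pers_module \<Rightarrow> bool" where
  "pm_isomorphic P Q \<longleftrightarrow>
    (\<exists>\<phi>. (\<forall>t>0. linear_iso (pm_space P t) (pm_space Q t) (\<phi> t)) \<and>
      (\<forall>s t. 0 < s \<longrightarrow> s \<le> t \<longrightarrow>
        (\<forall>x\<in>carrier (pm_space P s). \<phi> t (pm_map P s t x) = pm_map Q s t (\<phi> s x))))"

definition interval_module :: "real set \<Rightarrow> ('f::field, 'f) pers_module" where
  "interval_module I =
    \<lparr>pm_space = (\<lambda>t. vec_space (if t \<in> I then UNIV else {0}) 0 (+) (*)),
     pm_map = (\<lambda>s t x. if s \<in> I \<and> t \<in> I then x else 0)\<rparr>"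

definition pm_direct_sum ::
  "'l set \<Rightarrow> ('l \<Rightarrow> ('f::field, 'v) pers_module) \<Rightarrow> ('f, 'l \<Rightarrow> 'v) pers_module" where
  "pm_direct_sum L P =
    \<lparr>pm_space = (\<lambda>t. direct_sum_space L (\<lambda>l. pm_space (P l) t)),
     pm_map = (\<lambda>s t x. \<lambda>l\<in>L. pm_map (P l) s t (x l))\<rparr>"

text \<open>
  The barcode, a multiset of intervals whose multiplicities need not be finite a priori, is
  represented by an indexed family of intervals, determined up to reindexing.
\<close>

definition is_barcode ::
  "('f::field, 'v) pers_module \<Rightarrow> 'l set \<Rightarrow> ('l \<Rightarrow> real set) \<Rightarrow> bool" where
  "is_barcode P L I \<longleftrightarrow>
    (\<forall>l\<in>L. is_interval (I l) \<and> I l \<noteq> {} \<and> I l \<subseteq> {0<..}) \<and>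
    pm_isomorphic P (pm_direct_sum L (\<lambda>l. interval_module (I l)))"


section \<open>Vietoris--Rips persistent homology\<close>

definition VR :: "real \<Rightarrow> 'a::metric_space set \<Rightarrow> 'a set set" where
  "VR r X = {\<sigma>. \<sigma> \<subseteq> X \<and> finite \<sigma> \<and> \<sigma> \<noteq> {} \<and> diameter \<sigma> < r}"

definition PH_VR ::
  "nat \<Rightarrow> 'a::metric_space set \<Rightarrow> ('f::field, ('a set \<Rightarrow>\<^sub>0 'f) set) pers_module" where
  "PH_VR k X =
    \<lparr>pm_space = (\<lambda>r. homology k (VR r X)),
     pm_map = (\<lambda>r s. homology_incl k (VR s X))\<rparr>"

end

theory Submission
  imports Defs
begin

text \<open>
  A simplex of diameter less than \<open>t\<close> still has diameter less than some \<open>s < t\<close>, and chains have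
  finite support, so \<open>H\<^sub>k(VR\<^sub>t)\<close> is the colimit of the \<open>H\<^sub>k(VR\<^sub>s)\<close> with \<open>s < t\<close>.  Surjectivity onto
  the colimit forbids a bar to contain its infimum; injectivity forces a bounded bar to contain
  its supremum.
\<close>

section \<open>Bars of persistence modules that are continuous from below\<close>

lemma direct_sum_interval_carrier_iff:
  "x \<in> carrier (pm_space (pm_direct_sum L (\<lambda>l. interval_module (I l))) t) \<longleftrightarrow>
    x \<in> extensional L \<and> (\<forall>l\<in>L. t \<notin> I l \<longrightarrow> x l = 0) \<and> finite {l\<in>L. x l \<noteq> 0}"
  by (auto simp: pm_direct_sum_def direct_sum_space_def vec_space_def interval_module_def
      PiE_def Pi_def split: if_splits)

lemma direct_sum_interval_map:
  "pm_map (pm_direct_sum L (\<lambda>l. interval_module (I l))) s t x =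
    (\<lambda>l\<in>L. if s \<in> I l \<and> t \<in> I l then x l else 0)"
  by (simp add: pm_direct_sum_def interval_module_def)

lemma linear_iso_surj:
  assumes "linear_iso V W f" and "y \<in> carrier W"
  obtains x where "x \<in> carrier V" and "f x = y"
  using assms that unfolding linear_iso_def bij_betw_def by (metis imageE)

text \<open>The generator of the summand \<open>l\<close> at \<open>t\<close> comes from some
  earlier \<open>s\<close>. The map of the direct sum from \<open>s\<close> to \<open>t\<close>
  kills the coordinate \<open>l\<close> unless \<open>s\<close> lies in \<open>I l\<close>, so the
  bar already contains \<open>s\<close>.\<close>

lemma barcode_no_minimum:
  fixes P :: "('f::field, 'v) pers_module"
  assumes "is_barcode P L I" and "l \<in> L" and "t \<in> I l"
    and surj: "\<And>x. x \<in> carrier (pm_space P t) \<Longrightarrow>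
      \<exists>s y. 0 < s \<and> s < t \<and> y \<in> carrier (pm_space P s) \<and> pm_map P s t y = x"
  shows "\<exists>s\<in>I l. s < t"
proof -
  let ?Q = "pm_direct_sum L (\<lambda>l. interval_module (I l)) :: ('f, _) pers_module"
  from assms(1) obtain \<phi> where "I l \<subseteq> {0<..}"
    and iso: "\<And>t. t > 0 \<Longrightarrow> linear_iso (pm_space P t) (pm_space ?Q t) (\<phi> t)"
    and nat: "\<And>s t x. 0 < s \<Longrightarrow> s \<le> t \<Longrightarrow> x \<in> carrier (pm_space P s) \<Longrightarrow>
      \<phi> t (pm_map P s t x) = pm_map ?Q s t (\<phi> s x)"
    using \<open>l \<in> L\<close> unfolding is_barcode_def pm_isomorphic_def by blast
  then have "t > 0" using \<open>t \<in> I l\<close> by auto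
  define e :: "_ \<Rightarrow> 'f" where "e = (\<lambda>m\<in>L. if m = l then 1 else 0)"
  have "e \<in> carrier (pm_space ?Q t)"
    unfolding direct_sum_interval_carrier_iff using \<open>t \<in> I l\<close>
    by (auto simp: e_def intro: finite_subset[of _ "{l}"])
  with iso[OF \<open>t > 0\<close>] obtain x where x: "x \<in> carrier (pm_space P t)" "\<phi> t x = e"
    by (rule linear_iso_surj)
  from surj[OF x(1)] obtain s y where sy: "0 < s" "s < t" "y \<in> carrier (pm_space P s)"
    "pm_map P s t y = x" by blast
  have "pm_map ?Q s t (\<phi> s y) = e"
    using nat[of s t y] sy x(2) by simp
  then have "pm_map ?Q s t (\<phi> s y) l = 1"
    using \<open>l \<in> L\<close> by (simp add: e_def)
  then have "s \<in> I l"
    using \<open>l \<in> L\<close> by (simp add: direct_sum_interval_map split: if_splits)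
  with \<open>s < t\<close> show ?thesis by blast
qed

text \<open>If \<open>t\<close> were missing, the generator of the summand \<open>l\<close> at
  \<open>s\<close> would die at \<open>t\<close>, hence by \<open>inj\<close> already at some
  \<open>r\<close> before \<open>t\<close>. But \<open>alive\<close> keeps \<open>r\<close> in the
  bar, where that generator survives.\<close>

lemma barcode_supremum_mem:
  fixes P :: "('f::field, 'v) pers_module"
  assumes "is_barcode P L I" and "l \<in> L" and "s \<in> I l" and "s < t"
    and alive: "\<And>r. s \<le> r \<Longrightarrow> r < t \<Longrightarrow> r \<in> I l"
    and closed: "\<And>x. x \<in> carrier (pm_space P s) \<Longrightarrow> pm_map P s t x \<in> carrier (pm_space P t)"
    and inj: "\<And>x y. x \<in> carrier (pm_space P s) \<Longrightarrow> y \<in> carrier (pm_space P s) \<Longrightarrow>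
      pm_map P s t x = pm_map P s t y \<Longrightarrow>
      \<exists>r. s \<le> r \<and> r < t \<and> pm_map P s r x = pm_map P s r y"
  shows "t \<in> I l"
proof (rule ccontr)
  assume "t \<notin> I l"
  let ?Q = "pm_direct_sum L (\<lambda>l. interval_module (I l)) :: ('f, _) pers_module"
  from assms(1) obtain \<phi> where "I l \<subseteq> {0<..}"
    and iso: "\<And>t. t > 0 \<Longrightarrow> linear_iso (pm_space P t) (pm_space ?Q t) (\<phi> t)"
    and nat: "\<And>s t x. 0 < s \<Longrightarrow> s \<le> t \<Longrightarrow> x \<in> carrier (pm_space P s) \<Longrightarrow>
      \<phi> t (pm_map P s t x) = pm_map ?Q s t (\<phi> s x)"
    using \<open>l \<in> L\<close> unfolding is_barcode_def pm_isomorphic_def by blast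
  then have "s > 0" using \<open>s \<in> I l\<close> by auto
  define e :: "_ \<Rightarrow> 'f" where "e = (\<lambda>m\<in>L. if m = l then 1 else 0)"
  \<comment> \<open>Death is expressed by comparison with the zero vector: only bijectivity and
    naturality of \<open>\<phi>\<close> enter, not its linearity.\<close>
  define z :: "_ \<Rightarrow> 'f" where "z = (\<lambda>m\<in>L. 0)"
  have "e \<in> carrier (pm_space ?Q s)" "z \<in> carrier (pm_space ?Q s)"
    unfolding direct_sum_interval_carrier_iff using \<open>s \<in> I l\<close>
    by (auto simp: e_def z_def intro: finite_subset[of _ "{l}"])
  with iso[OF \<open>s > 0\<close>] obtain x y where x: "x \<in> carrier (pm_space P s)" "\<phi> s x = e"
    and y: "y \<in> carrier (pm_space P s)" "\<phi> s y = z"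
    by (metis linear_iso_surj)
  have "pm_map ?Q s t e = pm_map ?Q s t z"
    using \<open>t \<notin> I l\<close> by (auto simp: direct_sum_interval_map e_def z_def)
  then have "\<phi> t (pm_map P s t x) = \<phi> t (pm_map P s t y)"
    using nat[of s t x] nat[of s t y] x y \<open>s > 0\<close> \<open>s < t\<close> by simp
  moreover have "inj_on (\<phi> t) (carrier (pm_space P t))"
    using iso[of t] \<open>s > 0\<close> \<open>s < t\<close> by (simp add: linear_iso_def bij_betw_def)
  \<comment> \<open>\<open>\<phi> t\<close> is injective only on the carrier, and the record type
    does not force the maps of \<open>P\<close> to land there; \<open>closed\<close> supplies
    this.\<close>
  ultimately have "pm_map P s t x = pm_map P s t y"
    using closed x(1) y(1) by (meson inj_onD)
  from inj[OF x(1) y(1) this] obtain r where r: "s \<le> r" "r < t" "pm_map P s r x = pm_map P s r y"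
    by blast
  have "(pm_map ?Q s r e) l = (pm_map ?Q s r z) l"
    using nat[of s r x] nat[of s r y] x y r \<open>s > 0\<close> by simp
  then show False
    using alive[OF r(1,2)] \<open>s \<in> I l\<close> \<open>l \<in> L\<close> by (simp add: direct_sum_interval_map e_def z_def)
qed

text \<open>The endpoints are the infimum, which \<open>no_min\<close> excludes, and, if
  \<open>J\<close> is bounded above, the supremum, which \<open>sup_mem\<close> includes. Convexity
  fills in what lies between.\<close>

lemma interval_without_minimum_cases:
  fixes J :: "real set"
  assumes "is_interval J" and "J \<noteq> {}" and "J \<subseteq> {0<..}"
    and no_min: "\<And>t. t \<in> J \<Longrightarrow> \<exists>s\<in>J. s < t"
    and sup_mem: "\<And>s t. s \<in> J \<Longrightarrow> s < t \<Longrightarrow> (\<And>r. s \<le> r \<Longrightarrow> r < t \<Longrightarrow> r \<in> J) \<Longrightarrow> t \<in> J"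
  shows "\<exists>u v. 0 \<le> u \<and> u < v \<and> (J = {u<..v} \<or> J = {u<..})"
proof -
  have conv: "r \<in> J" if "a \<in> J" "b \<in> J" "a \<le> r" "r \<le> b" for a b r
    using assms(1) that unfolding is_interval_1 by blast
  define u where "u = Inf J"
  have bdd: "bdd_below J"
    using assms(3) by (intro bdd_belowI[of _ 0]) auto
  have lower: "u < t" if "t \<in> J" for t
    using no_min[OF that] cInf_lower[OF _ bdd] unfolding u_def by fastforce
  have approx: "\<exists>a\<in>J. a < t" if "u < t" for t
    using that cInf_less_iff[OF assms(2) bdd] unfolding u_def by blast
  have "0 \<le> u"
    unfolding u_def using assms(2,3) by (intro cInf_greatest) auto
  obtain p where "p \<in> J" using assms(2) by blast
  show ?thesis
  proof (cases "bdd_above J")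
    case True
    define v where "v = Sup J"
    have upper: "t \<le> v" if "t \<in> J" for t
      using cSup_upper[OF that True] by (simp add: v_def)
    have below: "t \<in> J" if "u < t" "t < v" for t
      using approx[OF \<open>u < t\<close>] less_cSup_iff[OF assms(2) True, of t] \<open>t < v\<close> conv
      unfolding v_def by (meson less_imp_le)
    have "v \<in> J"
    \<comment> \<open>\<open>sup_mem\<close> must start at a member of \<open>J\<close> strictly
      below \<open>v\<close>; if \<open>p\<close> is not such a point, it is \<open>v\<close>
      itself.\<close>
    proof (cases "p = v")
      case False
      with upper[OF \<open>p \<in> J\<close>] have "p < v" by simp
      moreover have "r \<in> J" if "p \<le> r" "r < v" for r
        using below lower[OF \<open>p \<in> J\<close>] that by simp
      ultimately show ?thesis by (rule sup_mem[OF \<open>p \<in> J\<close>])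
    qed (use \<open>p \<in> J\<close> in simp)
    have "t \<in> J \<longleftrightarrow> u < t \<and> t \<le> v" for t
      using lower upper below \<open>v \<in> J\<close> by (metis less_le)
    then have "J = {u<..v}" by (simp add: set_eq_iff)
    with \<open>0 \<le> u\<close> lower[OF \<open>v \<in> J\<close>] show ?thesis
      by (intro exI[of _ u] exI[of _ v]) simp
  next
    case False
    have "t \<in> J" if "u < t" for t
    proof -
      obtain b where "b \<in> J" "t \<le> b"
        using False unfolding bdd_above_def by (metis linear)
      moreover obtain a where "a \<in> J" "a < t"
        using approx[OF \<open>u < t\<close>] by blast
      ultimately show ?thesis by (intro conv[of a b t]) simp_all
    qed
    with lower have "t \<in> J \<longleftrightarrow> u < t" for t by blast
    then have "J = {u<..}" by (simp add: set_eq_iff)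
    with \<open>0 \<le> u\<close> show ?thesis
      \<comment> \<open>The ray does not mention \<open>v\<close>, so any real above
        \<open>u\<close> is a witness.\<close>
      by (intro exI[of _ u] exI[of _ "u + 1"]) simp
  qed
qed

section \<open>Homology classes under inclusions\<close>

lemma lookup_chain_scale:
  "Poly_Mapping.lookup (chain_scale a c) \<sigma> = a * Poly_Mapping.lookup c \<sigma>"
  by (simp add: chain_scale_def Poly_Mapping.map.rep_eq when_def)

text \<open>The added terms have coefficient zero. This lets the boundaries of several chains be
  written over one common index set.\<close>

lemma boundary_superset:
  assumes "finite A" and "Poly_Mapping.keys c \<subseteq> A"
  shows "boundary c =
    (\<Sum>\<sigma>\<in>A. chain_scale (Poly_Mapping.lookup c \<sigma>) (simplex_boundary \<sigma>))"
  unfolding boundary_def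
  by (rule sum.mono_neutral_left)
    (use assms in \<open>auto simp: in_keys_iff poly_mapping_eq_iff fun_eq_iff lookup_chain_scale\<close>)

lemma boundary_diff: "boundary (c - d) = boundary c - boundary d"
proof -
  let ?A = "Poly_Mapping.keys c \<union> Poly_Mapping.keys d"
  have scale: "chain_scale (a - b) e = chain_scale a e - chain_scale b e" for a b and e :: "'a set \<Rightarrow>\<^sub>0 'b"
    by (rule poly_mapping_eqI) (simp add: lookup_chain_scale lookup_minus algebra_simps)
  have "Poly_Mapping.keys (c - d) \<subseteq> ?A"
    by (auto simp: in_keys_iff lookup_minus)
  then show ?thesis
    by (simp add: boundary_superset[of ?A] lookup_minus scale sum_subtractf)
qed

lemma chains_diff:
  assumes "c \<in> chains k K" and "d \<in> chains k K"
  shows "c - d \<in> chains k K"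
  using assms keys_diff[of c d] unfolding chains_def by blast

lemma boundaries_diff:
  assumes "c \<in> boundaries k K" and "d \<in> boundaries k K"
  shows "c - d \<in> boundaries k K"
  using assms chains_diff unfolding boundaries_def by (force simp: boundary_diff[symmetric])

lemma boundaries_zero: "0 \<in> boundaries k K"
  using boundaries_diff[of _ k K] unfolding boundaries_def chains_def
  by (auto simp: image_iff boundary_def intro!: exI[of _ 0])

lemma boundaries_add:
  assumes "c \<in> boundaries k K" and "d \<in> boundaries k K"
  shows "c + d \<in> boundaries k K"
  \<comment> \<open>Here \<open>c + d\<close> is obtained as \<open>c - (0 - d)\<close>.\<close>
  using boundaries_diff[OF assms(1) boundaries_diff[OF boundaries_zero assms(2)]] by simp

lemma chains_mono: "K \<subseteq> K' \<Longrightarrow> chains k K \<subseteq> chains k K'"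
  unfolding chains_def simplices_def by blast

lemma cycles_mono: "K \<subseteq> K' \<Longrightarrow> cycles k K \<subseteq> cycles k K'"
  using chains_mono unfolding cycles_def by blast

lemma boundaries_mono: "K \<subseteq> K' \<Longrightarrow> boundaries k K \<subseteq> boundaries k K'"
  using chains_mono unfolding boundaries_def by blast

text \<open>Cosets are restated in the additive group of all finitely supported functions, so that
  they can be compared by plain arithmetic, without the algebra records.\<close>

definition homology_class :: "nat \<Rightarrow> 'a set set \<Rightarrow> ('a set \<Rightarrow>\<^sub>0 'f::field) \<Rightarrow> ('a set \<Rightarrow>\<^sub>0 'f) set" where
  "homology_class k K z = (\<lambda>b. b + z) ` boundaries k K"

lemma coset_eq_homology_class: "boundaries k K +>\<^bsub>cycle_space k K\<^esub> z = homology_class k K z"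
  by (auto simp: a_r_coset_def' homology_class_def cycle_space_def vec_space_def)

lemma carrier_homology: "carrier (homology k K) = homology_class k K ` cycles k K"
  unfolding homology_def quotient_space_def
  by (auto simp: vec_space_def A_RCOSETS_def' a_r_coset_def' homology_class_def cycle_space_def)

lemma homology_class_eq_iff:
  "homology_class k K z = homology_class k K w \<longleftrightarrow> z - w \<in> boundaries k K"
proof
  assume "homology_class k K z = homology_class k K w"
  moreover have "z \<in> homology_class k K z"
    using boundaries_zero by (force simp: homology_class_def)
  ultimately show "z - w \<in> boundaries k K"
    by (auto simp: homology_class_def)
next
  assume zw: "z - w \<in> boundaries k K"
  \<comment> \<open>Translation by the boundary \<open>z - w\<close> turns elements of either coset
    into elements of the other.\<close>
  have "b + z = (b + (z - w)) + w" "b + w = (b - (z - w)) + z" for b by auto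
  with zw show "homology_class k K z = homology_class k K w"
    unfolding homology_class_def using boundaries_add[OF _ zw] boundaries_diff[OF _ zw]
    by (metis (no_types, lifting) image_iff subsetI subset_antisym)
qed

text \<open>Representatives of one class differ by boundaries of \<open>K\<close>, which are
  boundaries of \<open>K'\<close>, so every term of the union defining \<open>homology_incl\<close>
  is the same coset; the union is over a nonempty set because 0 is a boundary.\<close>

lemma homology_incl_class:
  assumes "K \<subseteq> K'"
  shows "homology_incl k K' (homology_class k K z) = homology_class k K' z"
proof -
  have "homology_class k K' (b + z) = homology_class k K' z" if "b \<in> boundaries k K" for b
    using that boundaries_mono[OF assms] by (auto simp: homology_class_eq_iff)
  then show ?thesis
    using boundaries_zero[of k K]
    by (auto simp: homology_incl_def coset_eq_homology_class homology_class_def[of k K])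
qed

section \<open>Continuity from below of the Vietoris--Rips filtration\<close>

lemma VR_mono: "r \<le> s \<Longrightarrow> VR r X \<subseteq> VR s X"
  by (auto simp: VR_def)

text \<open>Only finitely many simplices occur in \<open>c\<close>, each of diameter strictly below
  \<open>t\<close>, so their largest diameter is below \<open>t\<close> too.\<close>

lemma chains_VR_below:
  assumes "c \<in> chains k (VR t X)" and "s < t"
  obtains r where "s < r" and "r < t" and "c \<in> chains k (VR r X)"
proof -
  \<comment> \<open>Including \<open>s\<close> keeps the set nonempty when \<open>c\<close> is zero
    and forces \<open>r\<close> above \<open>s\<close>.\<close>
  let ?D = "insert s (diameter ` Poly_Mapping.keys c)"
  have "Max ?D < t"
    using assms by (auto simp: chains_def simplices_def VR_def)
  then obtain r where r: "Max ?D < r" "r < t" using dense by blast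
  then have "s < r" "\<forall>\<sigma>\<in>Poly_Mapping.keys c. diameter \<sigma> < r" by auto
  moreover from this have "c \<in> chains k (VR r X)"
    using assms by (auto simp: chains_def simplices_def VR_def)
  ultimately show ?thesis using r(2) that by blast
qed

text \<open>A representing cycle is already a chain at some smaller scale, and it remains a cycle
  there because \<open>boundary\<close> does not refer to the complex.\<close>

lemma PH_VR_surj_from_below:
  assumes "x \<in> carrier (pm_space (PH_VR k X) t)" and "0 < t"
  shows "\<exists>s y. 0 < s \<and> s < t \<and> y \<in> carrier (pm_space (PH_VR k X) s) \<and>
    pm_map (PH_VR k X) s t y = x"
proof -
  obtain z where z: "z \<in> cycles k (VR t X)" "x = homology_class k (VR t X) z"
    using assms(1) by (auto simp: PH_VR_def carrier_homology)
  then obtain s where s: "0 < s" "s < t" "z \<in> chains k (VR s X)"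
    \<comment> \<open>The lower bound 0 makes the smaller scale positive.\<close>
    using chains_VR_below[OF _ \<open>0 < t\<close>] unfolding cycles_def by blast
  then have "z \<in> cycles k (VR s X)" using z(1) by (simp add: cycles_def)
  with z(2) s show ?thesis
    by (auto simp: PH_VR_def carrier_homology homology_incl_class[OF VR_mono]
        intro!: exI[of _ s] exI[of _ "homology_class k (VR s X) z"])
qed

lemma PH_VR_map_carrier:
  assumes "x \<in> carrier (pm_space (PH_VR k X) s)" and "s \<le> t"
  shows "pm_map (PH_VR k X) s t x \<in> carrier (pm_space (PH_VR k X) t)"
  using assms cycles_mono[OF VR_mono[OF \<open>s \<le> t\<close>]]
  by (fastforce simp: PH_VR_def carrier_homology homology_incl_class[OF VR_mono])

text \<open>Two classes merge at \<open>t\<close> through a single chain bounding the difference of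
  their representatives; that chain exists at some scale before \<open>t\<close>, so they merge
  there already.\<close>

lemma PH_VR_inj_from_below:
  assumes "x \<in> carrier (pm_space (PH_VR k X) s)" and "y \<in> carrier (pm_space (PH_VR k X) s)"
    and "pm_map (PH_VR k X) s t x = pm_map (PH_VR k X) s t y" and "s < t"
  shows "\<exists>r. s \<le> r \<and> r < t \<and> pm_map (PH_VR k X) s r x = pm_map (PH_VR k X) s r y"
proof -
  obtain z w where zw: "x = homology_class k (VR s X) z" "y = homology_class k (VR s X) w"
    using assms(1,2) by (auto simp: PH_VR_def carrier_homology)
  have map: "pm_map (PH_VR k X) s r x = pm_map (PH_VR k X) s r y \<longleftrightarrow>
      z - w \<in> boundaries k (VR r X)" if "s \<le> r" for r
    using that by (simp add: zw PH_VR_def homology_incl_class[OF VR_mono] homology_class_eq_iff)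
  have "z - w \<in> boundaries k (VR t X)"
    using map[of t] assms(3,4) by simp
  then obtain c where c: "c \<in> chains (Suc k) (VR t X)" "z - w = boundary c"
    unfolding boundaries_def by blast
  obtain r where "s < r" "r < t" "c \<in> chains (Suc k) (VR r X)"
    using chains_VR_below[OF c(1) \<open>s < t\<close>] .
  then show ?thesis
    using map[of r] c(2) by (auto simp: boundaries_def intro!: exI[of _ r])
qed

theorem theorem8:
  fixes X :: "'a::metric_space set" and k :: nat
    and L :: "'l set" and barc :: "'l \<Rightarrow> real set"
  assumes "compact X"
    and "is_barcode (PH_VR k X :: ('f::field, ('a set \<Rightarrow>\<^sub>0 'f) set) pers_module) L barc"
    and "l \<in> L"
  shows "\<exists>u v. 0 \<le> u \<and> u < v \<and> (barc l = {u<..v} \<or> barc l = {u<..})"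
proof (rule interval_without_minimum_cases)
  show "is_interval (barc l)" "barc l \<noteq> {}" and pos: "barc l \<subseteq> {0<..}"
    using assms(2,3) by (auto simp: is_barcode_def)
  show "\<exists>s\<in>barc l. s < t" if "t \<in> barc l" for t
    using barcode_no_minimum[OF assms(2,3) that] PH_VR_surj_from_below pos that by blast
  show "t \<in> barc l" if s: "s \<in> barc l" "s < t" "\<And>r. s \<le> r \<Longrightarrow> r < t \<Longrightarrow> r \<in> barc l" for s t
  proof (rule barcode_supremum_mem[OF assms(2,3) s])
    fix x y :: "('a set \<Rightarrow>\<^sub>0 'f) set"
    assume x: "x \<in> carrier (pm_space (PH_VR k X) s)"
    then show "pm_map (PH_VR k X) s t x \<in> carrier (pm_space (PH_VR k X) t)"
      using \<open>s < t\<close> by (intro PH_VR_map_carrier) simp_all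
    assume "y \<in> carrier (pm_space (PH_VR k X) s)"
      and "pm_map (PH_VR k X) s t x = pm_map (PH_VR k X) s t y"
    with x show "\<exists>r. s \<le> r \<and> r < t \<and> pm_map (PH_VR k X) s r x = pm_map (PH_VR k X) s r y"
      using \<open>s < t\<close> by (rule PH_VR_inj_from_below)
  qed simp_all
qed

end
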